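(* For every integer $n\geq 2$ there is a polynomial $p_n$, depending only on $n$, such that the following holds. Let $F_n$ be the free group of rank $n$ with a fixed free generating set $x_1,\dots,x_n$, and let $w\in F_n$. Then there is an automorphism $\alpha\in\operatorname{Aut}(F_n)$ such that $\alpha(w)$ has zero exponent sum in at least one of the generators $x_1,\dots,x_n$ and such that $\ell(\alpha(w))\leq p_n(\ell(w))$.
   Context: $\ell(v)$ denotes the word length of $v\in F_n$ with respect to the fixed free generating set $x_1,\dots,x_n$ (the length of the reduced word in $x_1^{\pm1},\dots,x_n^{\pm1}$ representing $v$). The exponent sum of the generator $x_i$ in $v$ is the sum of the exponents of all occurrences of $x_i$ in a word representing $v$, i.e. the image of $v$ under the homomorphism $F_n\to\mathbb{Z}$ sending $x_i\mapsto 1$ and $x_j\mapsto 0$ for $j\neq i$. A polynomial means a one-variable polynomial with real coefficients. *)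

theory Defs
  imports
    "HOL-Algebra.Bij"
    "HOL-Algebra.Elementary_Groups"
    "HOL-Computational_Algebra.Polynomial"
begin

(* (i, True) is the letter x_i, and (i, False) is the letter x_i^{-1}. *)
type_synonym letter = "nat \<times> bool"

definition inv_letter :: "letter \<Rightarrow> letter" where
  "inv_letter x = (fst x, \<not> snd x)"

definition reduced :: "letter list \<Rightarrow> bool" where
  "reduced v \<longleftrightarrow> successively (\<lambda>x y. y \<noteq> inv_letter x) v"

fun push_letter :: "letter \<Rightarrow> letter list \<Rightarrow> letter list" where
  "push_letter x [] = [x]"
| "push_letter x (y # v) = (if y = inv_letter x then v else x # y # v)"

definition reduce :: "letter list \<Rightarrow> letter list" where
  "reduce v = foldr push_letter v []"

definition words :: "nat \<Rightarrow> letter list set" where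
  "words n = {v. fst ` set v \<subseteq> {1..n}}"

(* Each element is its own reduced word in x_1, ..., x_n, so its length as a list is its word
   length. *)
definition free_group :: "nat \<Rightarrow> letter list monoid" where
  "free_group n =
    \<lparr>carrier = {v \<in> words n. reduced v}, monoid.mult = (\<lambda>u v. reduce (u @ v)), one = []\<rparr>"

definition free_gen :: "nat \<Rightarrow> letter list" where
  "free_gen i = [(i, True)]"

definition word_length :: "letter list \<Rightarrow> nat" where
  "word_length v = length v"

definition exponent_sum :: "nat \<Rightarrow> letter list \<Rightarrow> int" where
  "exponent_sum i v = (\<Sum>x\<leftarrow>v. if fst x = i then (if snd x then 1 else - 1) else 0)"


lemma inv_letter_inv_letter [simp]: "inv_letter (inv_letter x) = x"
  by (simp add: inv_letter_def)

lemma inv_letter_neq [simp]: "inv_letter x \<noteq> x" "x \<noteq> inv_letter x"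
  by (auto simp: inv_letter_def prod_eq_iff)

lemma fst_inv_letter [simp]: "fst (inv_letter x) = fst x"
  by (simp add: inv_letter_def)

lemma reduced_Nil [simp]: "reduced []"
  by (simp add: reduced_def)

lemma reduced_Cons: "reduced (x # v) \<longleftrightarrow> reduced v \<and> (v = [] \<or> hd v \<noteq> inv_letter x)"
  by (cases v) (auto simp: reduced_def)

lemma reduced_push_letter: "reduced v \<Longrightarrow> reduced (push_letter x v)"
  by (cases v) (auto simp: reduced_Cons)

lemma push_letter_cancel: "reduced v \<Longrightarrow> push_letter x (push_letter (inv_letter x) v) = v"
  by (cases v; cases "tl v") (auto simp: reduced_Cons)

lemma push_letter_cancel': "reduced v \<Longrightarrow> push_letter (inv_letter x) (push_letter x v) = v"
  using push_letter_cancel[of v "inv_letter x"] by simp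

lemma set_push_letter: "set (push_letter x v) \<subseteq> insert x (set v)"
  by (cases v) auto

lemma reduced_foldr_push: "reduced v \<Longrightarrow> reduced (foldr push_letter u v)"
  by (induction u) (auto intro: reduced_push_letter)

lemma set_foldr_push: "set (foldr push_letter u v) \<subseteq> set u \<union> set v"
proof (induction u)
  case (Cons x u)
  then show ?case using set_push_letter[of x "foldr push_letter u v"] by auto
qed simp

lemma reduced_reduce [simp]: "reduced (reduce v)"
  by (simp add: reduce_def reduced_foldr_push)

lemma reduce_in_words: "v \<in> words n \<Longrightarrow> reduce v \<in> words n"
  using set_foldr_push[of v "[]"] by (fastforce simp: words_def reduce_def)

lemma reduce_reduced: "reduced v \<Longrightarrow> reduce v = v"
proof (induction v)
  case (Cons x v)
  then show ?case by (cases v) (auto simp: reduce_def reduced_Cons)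
qed (simp add: reduce_def)

lemma reduce_append: "reduce (u @ v) = foldr push_letter u (reduce v)"
  by (simp add: reduce_def)

lemma foldr_push_push:
  "reduced v \<Longrightarrow> foldr push_letter (push_letter x u) v = push_letter x (foldr push_letter u v)"
  by (cases u) (auto simp: push_letter_cancel reduced_foldr_push)

lemma foldr_push_reduce: "reduced v \<Longrightarrow> foldr push_letter (reduce u) v = foldr push_letter u v"
  by (induction u) (auto simp: reduce_def foldr_push_push)

lemma reduce_append_reduce1 [simp]: "reduce (reduce u @ v) = reduce (u @ v)"
  by (simp add: reduce_append foldr_push_reduce)

lemma reduce_append_reduce2 [simp]: "reduce (u @ reduce v) = reduce (u @ v)"
  by (simp add: reduce_append reduce_reduced)

lemma reduce_inverse: "reduce (map inv_letter (rev v) @ v) = []"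
proof (induction v)
  case Nil
  then show ?case by (simp add: reduce_def)
next
  case (Cons x v)
  have "reduce (map inv_letter (rev (x # v)) @ x # v)
      = foldr push_letter (map inv_letter (rev v)) (reduce ([inv_letter x, x] @ v))"
    by (simp add: reduce_def)
  also have "reduce ([inv_letter x, x] @ v) = reduce v"
    using push_letter_cancel'[of "reduce v" x] by (simp add: reduce_def reduced_foldr_push)
  finally show ?case using Cons by (simp add: reduce_append)
qed

lemma free_group_simps [simp]:
  "carrier (free_group n) = {v \<in> words n. reduced v}"
  "u \<otimes>\<^bsub>free_group n\<^esub> v = reduce (u @ v)"
  "\<one>\<^bsub>free_group n\<^esub> = []"
  by (simp_all add: free_group_def)

lemma words_append [simp]: "u @ v \<in> words n \<longleftrightarrow> u \<in> words n \<and> v \<in> words n"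
  by (auto simp: words_def)

lemma words_Nil [simp]: "[] \<in> words n"
  by (simp add: words_def)

theorem group_free_group: "group (free_group n)"
proof (rule groupI)
  fix v assume v: "v \<in> carrier (free_group n)"
  let ?u = "reduce (map inv_letter (rev v))"
  have "map inv_letter (rev v) \<in> words n"
    using v by (auto simp: words_def)
  then have "?u \<in> carrier (free_group n)"
    by (simp add: reduce_in_words)
  moreover have "?u \<otimes>\<^bsub>free_group n\<^esub> v = \<one>\<^bsub>free_group n\<^esub>"
    by (simp add: reduce_inverse)
  ultimately show "\<exists>u\<in>carrier (free_group n). u \<otimes>\<^bsub>free_group n\<^esub> v = \<one>\<^bsub>free_group n\<^esub>"
    by blast
qed (auto simp: reduce_in_words reduce_reduced)

lemma free_gen_in_carrier: "i \<in> {1..n} \<Longrightarrow> free_gen i \<in> carrier (free_group n)"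
  by (auto simp: free_gen_def words_def reduced_Cons)


lemma exponent_sum_Nil [simp]: "exponent_sum i [] = 0"
  by (simp add: exponent_sum_def)

lemma exponent_sum_append: "exponent_sum i (u @ v) = exponent_sum i u + exponent_sum i v"
  by (simp add: exponent_sum_def)

lemma exponent_sum_push_letter: "exponent_sum i (push_letter x v) = exponent_sum i (x # v)"
  by (cases v) (auto simp: exponent_sum_def inv_letter_def)

lemma exponent_sum_reduce: "exponent_sum i (reduce v) = exponent_sum i v"
proof (induction v)
  case (Cons x v)
  then show ?case
    using exponent_sum_push_letter[of i x "reduce v"]
    by (simp add: reduce_def exponent_sum_def)
qed (simp add: reduce_def)

theorem exponent_sum_hom: "exponent_sum i \<in> hom (free_group n) integer_group"
  by (auto simp: hom_def exponent_sum_reduce exponent_sum_append)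

lemma exponent_sum_free_gen: "exponent_sum i (free_gen j) = (if j = i then 1 else 0)"
  by (simp add: exponent_sum_def free_gen_def)


(* The universal property: free_gen 1, ..., free_gen n is a free generating set. *)

fun eval_letter :: "('a, 'b) monoid_scheme \<Rightarrow> (nat \<Rightarrow> 'a) \<Rightarrow> letter \<Rightarrow> 'a" where
  "eval_letter H f (i, b) = (if b then f i else inv\<^bsub>H\<^esub> f i)"

fun eval_word :: "('a, 'b) monoid_scheme \<Rightarrow> (nat \<Rightarrow> 'a) \<Rightarrow> letter list \<Rightarrow> 'a" where
  "eval_word H f [] = \<one>\<^bsub>H\<^esub>"
| "eval_word H f (x # v) = eval_letter H f x \<otimes>\<^bsub>H\<^esub> eval_word H f v"

lemma words_Cons: "x # v \<in> words n \<longleftrightarrow> fst x \<in> {1..n} \<and> v \<in> words n"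
  by (auto simp: words_def)

context
  fixes H :: "('a, 'b) monoid_scheme" (structure) and f :: "nat \<Rightarrow> 'a" and n :: nat
  assumes H: "group H" and f: "f \<in> {1..n} \<rightarrow> carrier H"
begin

interpretation group H by (rule H)

lemma eval_letter_closed: "fst x \<in> {1..n} \<Longrightarrow> eval_letter H f x \<in> carrier H"
  using f by (cases x) (auto simp: Pi_iff)

lemma eval_word_closed: "v \<in> words n \<Longrightarrow> eval_word H f v \<in> carrier H"
  by (induction v) (auto simp: words_Cons eval_letter_closed)

lemma eval_letter_inv_letter:
  "fst x \<in> {1..n} \<Longrightarrow> eval_letter H f x \<otimes> eval_letter H f (inv_letter x) = \<one>"
  using f by (cases x) (auto simp: inv_letter_def Pi_iff)

lemma eval_word_append:
  "u \<in> words n \<Longrightarrow> v \<in> words n \<Longrightarrow> eval_word H f (u @ v) = eval_word H f u \<otimes> eval_word H f v"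
  by (induction u) (auto simp: words_Cons eval_letter_closed eval_word_closed m_assoc)

lemma eval_word_push_letter:
  assumes "x # v \<in> words n"
  shows "eval_word H f (push_letter x v) = eval_word H f (x # v)"
proof (cases v)
  case (Cons y v')
  then have "y = inv_letter x \<Longrightarrow>
      eval_letter H f x \<otimes> (eval_letter H f y \<otimes> eval_word H f v') = eval_word H f v'"
    using assms eval_letter_inv_letter[of x]
    by (simp add: words_Cons eval_letter_closed eval_word_closed m_assoc[symmetric])
  then show ?thesis using Cons by auto
qed simp

lemma eval_word_reduce: "v \<in> words n \<Longrightarrow> eval_word H f (reduce v) = eval_word H f v"
proof (induction v)
  case (Cons x v)
  have "x # reduce v \<in> words n"
    using Cons.prems by (simp add: words_Cons reduce_in_words)
  from eval_word_push_letter[OF this] Cons show ?case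
    by (simp add: reduce_def words_Cons)
qed (simp add: reduce_def)

theorem free_group_extend_hom:
  "eval_word H f \<in> hom (free_group n) H"
  "i \<in> {1..n} \<Longrightarrow> eval_word H f (free_gen i) = f i"
  using f by (auto simp: hom_def eval_word_closed eval_word_reduce eval_word_append
      free_gen_def Pi_iff)

theorem free_group_extend_unique:
  assumes h: "h \<in> hom (free_group n) H" and gen: "\<And>i. i \<in> {1..n} \<Longrightarrow> h (free_gen i) = f i"
    and v: "v \<in> carrier (free_group n)"
  shows "h v = eval_word H f v"
  using v
proof (induction v)
  case Nil
  show ?case
    using group_hom.hom_one[OF group_hom.intro[OF group_free_group H group_hom_axioms.intro[OF h]]]
    by simp
next
  case (Cons x v)
  interpret h: group_hom "free_group n" H h
    by (rule group_hom.intro[OF group_free_group H group_hom_axioms.intro[OF h]])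
  obtain i b where x: "x = (i, b)" by (cases x)
  have i: "i \<in> {1..n}" and v: "v \<in> carrier (free_group n)"
    and red: "reduced (x # v)"
    using Cons.prems x by (auto simp: words_Cons reduced_Cons)
  have gi: "free_gen i \<in> carrier (free_group n)" by (rule free_gen_in_carrier[OF i])
  have letter: "[x] \<in> carrier (free_group n)"
    using i x by (auto simp: words_def reduced_Cons)
  have "h [x] = eval_letter H f x"
  proof (cases b)
    case True
    then show ?thesis using gen[OF i] x by (simp add: free_gen_def)
  next
    case False
    have "inv\<^bsub>free_group n\<^esub> (free_gen i) = [x]"
      by (rule group.inv_equality[OF group_free_group])
        (use gi letter False x in \<open>auto simp: free_gen_def reduce_def inv_letter_def\<close>)
    then show ?thesis using h.hom_inv[OF gi] gen[OF i] x False by simp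
  qed
  moreover have "x # v = [x] \<otimes>\<^bsub>free_group n\<^esub> v"
    using reduce_reduced[OF red] by simp
  ultimately show ?case
    using h.hom_mult[OF letter v] Cons.IH[OF v] by (metis eval_word.simps(2))
qed

end

end

theory Submission
  imports Defs
begin

text \<open>
  It suffices to work with two of the generators. For $i \neq j$, the
  transvection $x_i \mapsto x_i x_j^c$ keeps the exponent sum $a$ of $x_i$, changes the exponent
  sum $b$ of $x_j$ into $b + c a$, and multiplies the length by at most $1 + |c|$. The Euclidean
  algorithm on $(|a|, |b|)$, with each division step carried out by one transvection, therefore
  ends in a word in which one of the two exponent sums is zero.

  The length stays polynomial because the product of the factors $1 + q$ over all quotients $q$ of
  the algorithm is at most $(1 + |a|)(1 + |b|)$. Indeed, a division step $B = q A + R$ with $R < A$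
  satisfies $(1 + q)(1 + R) \le 1 + B$ (lemma \<open>euclid_step_cost\<close>), so that the potential
  $(1 + A)(1 + B)$ loses at least the factor $1 + q$ when $(A, B)$ becomes $(R, A)$. As both
  exponent sums are bounded by the length $\ell$, the final word has length at most
  $\ell (1 + \ell)^2$.
\<close>

section \<open>Endomorphisms of the free group\<close>

lemma length_reduce_le: "length (reduce v) \<le> length v"
proof (induction v)
  case (Cons x v)
  have "length (push_letter x u) \<le> Suc (length u)" for u
    by (cases u) auto
  from this[of "reduce v"] Cons show ?case by (simp add: reduce_def)
qed (simp add: reduce_def)

lemma inv_free_group:
  assumes "v \<in> carrier (free_group n)"
  shows "inv\<^bsub>free_group n\<^esub> v = reduce (map inv_letter (rev v))"
proof (rule group.inv_equality[OF group_free_group])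
  have "map inv_letter (rev v) \<in> words n"
    using assms by (auto simp: words_def)
  then show "reduce (map inv_letter (rev v)) \<in> carrier (free_group n)"
    by (simp add: reduce_in_words)
qed (use assms in \<open>simp_all add: reduce_inverse\<close>)

lemma exponent_sum_Cons: "exponent_sum k (x # v) = exponent_sum k [x] + exponent_sum k v"
  using exponent_sum_append[of k "[x]" v] by simp

lemma exponent_sum_inverse: "exponent_sum k (map inv_letter (rev v)) = - exponent_sum k v"
proof (induction v)
  case (Cons x v)
  then show ?case
    by (subst exponent_sum_Cons) (simp add: exponent_sum_append,
        simp add: exponent_sum_def inv_letter_def)
qed simp

lemma abs_exponent_sum_le_length: "\<bar>exponent_sum k v\<bar> \<le> int (length v)"
proof (induction v)
  case (Cons x v)
  have "\<bar>exponent_sum k [x]\<bar> \<le> 1"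
    by (simp add: exponent_sum_def)
  with Cons show ?case
    by (subst exponent_sum_Cons) simp
qed simp

lemma length_eval_word_le:
  assumes f: "f \<in> {1..n} \<rightarrow> carrier (free_group n)"
    and len: "\<And>l. l \<in> {1..n} \<Longrightarrow> length (f l) \<le> M"
    and v: "v \<in> words n"
  shows "length (eval_word (free_group n) f v) \<le> M * length v"
  using v
proof (induction v)
  case (Cons x v)
  obtain l b where x: "x = (l, b)" by (cases x)
  have l: "l \<in> {1..n}" using Cons.prems x by (simp add: words_Cons)
  have "length (inv\<^bsub>free_group n\<^esub> (f l)) \<le> length (f l)"
    using length_reduce_le[of "map inv_letter (rev (f l))"] inv_free_group[of "f l" n] f l
    by (simp add: Pi_iff)
  with len[OF l] have "length (eval_letter (free_group n) f x) \<le> M"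
    by (auto simp: x)
  moreover have "length (eval_word (free_group n) f (x # v))
      \<le> length (eval_letter (free_group n) f x) + length (eval_word (free_group n) f v)"
    using length_reduce_le[of "eval_letter (free_group n) f x @ eval_word (free_group n) f v"]
    by simp
  ultimately show ?case using Cons by (simp add: words_Cons)
qed simp

text \<open>Both sides are homomorphisms to the integers, so the identity has only to be checked on the
  generators. For a transvection, $c$ is its exponent if $x_k$ is the generator it multiplies by,
  and $0$ otherwise.\<close>

lemma exponent_sum_eval_word:
  assumes f: "f \<in> {1..n} \<rightarrow> carrier (free_group n)"
    and gen: "\<And>l. l \<in> {1..n} \<Longrightarrow>
      exponent_sum k (f l) = exponent_sum k (free_gen l) + c * exponent_sum i (free_gen l)"
    and v: "v \<in> words n"
  shows "exponent_sum k (eval_word (free_group n) f v)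
    = exponent_sum k v + c * exponent_sum i v"
  using v
proof (induction v)
  case (Cons x v)
  obtain l b where x: "x = (l, b)" by (cases x)
  have l: "l \<in> {1..n}" using Cons.prems x by (simp add: words_Cons)
  have fl: "f l \<in> carrier (free_group n)" using f l by auto
  have "exponent_sum k (eval_letter (free_group n) f x) = exponent_sum k [x] + c * exponent_sum i [x]"
    using gen[OF l] inv_free_group[OF fl]
    by (cases b) (simp_all add: x exponent_sum_reduce exponent_sum_inverse,
        simp_all add: free_gen_def exponent_sum_def)
  with Cons show ?case
    by (simp add: exponent_sum_reduce exponent_sum_append words_Cons exponent_sum_Cons[of _ x v]
        algebra_simps)
qed simp

lemma eval_word_fixed_letters:
  assumes "v \<in> words n" and "\<And>l. l \<in> fst ` set v \<Longrightarrow> f l = free_gen l"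
  shows "eval_word (free_group n) f v = reduce v"
  using assms
proof (induction v)
  case (Cons x v)
  obtain l b where x: "x = (l, b)" by (cases x)
  have "eval_letter (free_group n) f x = [x]"
    using Cons.prems free_gen_in_carrier[of l n]
    by (cases b) (auto simp: x words_Cons inv_free_group,
        auto simp: free_gen_def inv_letter_def reduce_def)
  then show ?case
    using Cons reduce_append_reduce2[of "[x]" v] by (simp add: words_Cons)
qed (simp add: reduce_def)

text \<open>A composite of endomorphisms is determined by its values on the generators, hence two
  substitutions that cancel on the generators cancel everywhere.\<close>

lemma eval_word_cancel:
  assumes f: "f \<in> {1..n} \<rightarrow> carrier (free_group n)"
    and g: "g \<in> {1..n} \<rightarrow> carrier (free_group n)"
    and gen: "\<And>l. l \<in> {1..n} \<Longrightarrow> eval_word (free_group n) f (g l) = free_gen l"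
    and v: "v \<in> carrier (free_group n)"
  shows "eval_word (free_group n) f (eval_word (free_group n) g v) = v"
proof -
  let ?G = "free_group n"
  have G: "group ?G" by (rule group_free_group)
  have "eval_word ?G f \<circ> eval_word ?G g \<in> hom ?G ?G"
    by (rule hom_compose[OF free_group_extend_hom(1)[OF G g] free_group_extend_hom(1)[OF G f]])
  then have "(eval_word ?G f \<circ> eval_word ?G g) v = eval_word ?G free_gen v"
    by (rule free_group_extend_unique[OF G, rotated])
      (use gen v free_group_extend_hom(2)[OF G g] free_gen_in_carrier in \<open>auto simp del: free_group_simps\<close>)
  also have "\<dots> = v"
    using eval_word_fixed_letters[of v n free_gen] v by (simp add: reduce_reduced)
  finally show ?thesis by simp
qed

section \<open>Transvections\<close>

text \<open>The reduced word of $x_j^c$; for $c = 0$ it has no letters.\<close>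

definition gen_power :: "nat \<Rightarrow> int \<Rightarrow> letter list" where
  "gen_power j c = replicate (nat \<bar>c\<bar>) (j, 0 \<le> c)"

definition transvection_gen :: "nat \<Rightarrow> nat \<Rightarrow> int \<Rightarrow> nat \<Rightarrow> letter list" where
  "transvection_gen i j c l =
    (if l = i then free_gen i @ gen_power j c else free_gen l)"

text \<open>Automorphisms are extensional functions, hence the restriction to the carrier.\<close>

definition transvection :: "nat \<Rightarrow> nat \<Rightarrow> nat \<Rightarrow> int \<Rightarrow> letter list \<Rightarrow> letter list" where
  "transvection n i j c
    = restrict (eval_word (free_group n) (transvection_gen i j c)) (carrier (free_group n))"

lemma reduced_replicate: "reduced (replicate m x)"
  by (induction m) (auto simp: reduced_Cons)

lemma gen_power_in_words: "j \<in> {1..n} \<Longrightarrow> gen_power j c \<in> words n"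
  by (auto simp: gen_power_def words_def)

lemma exponent_sum_gen_power: "exponent_sum k (gen_power j c) = (if k = j then c else 0)"
  by (auto simp: gen_power_def exponent_sum_def sum_list_replicate)

lemma reduce_gen_power_cancel: "reduce (gen_power j c @ gen_power j (- c)) = []"
proof -
  have "gen_power j c = map inv_letter (rev (gen_power j (- c)))"
    by (auto simp: gen_power_def inv_letter_def)
  then show ?thesis by (simp add: reduce_inverse)
qed

lemma transvection_gen_closed:
  assumes "i \<in> {1..n}" "j \<in> {1..n}" "i \<noteq> j"
  shows "transvection_gen i j c \<in> {1..n} \<rightarrow> carrier (free_group n)"
proof -
  have "reduced (free_gen i @ gen_power j c)"
    using assms(3) by (auto simp: free_gen_def gen_power_def reduced_Cons reduced_replicate
        hd_replicate inv_letter_def)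
  then show ?thesis
    using assms(1,2) free_gen_in_carrier gen_power_in_words
    by (auto simp: transvection_gen_def)
qed

lemma transvection_gen_cancel:
  assumes "i \<in> {1..n}" "j \<in> {1..n}" "i \<noteq> j" "l \<in> {1..n}"
  shows "eval_word (free_group n) (transvection_gen i j c) (transvection_gen i j (- c) l)
    = free_gen l"
proof (cases "l = i")
  case True
  let ?f = "transvection_gen i j c"
  note f = transvection_gen_closed[OF assms(1-3), of c]
  have "eval_word (free_group n) ?f (gen_power j (- c)) = reduce (gen_power j (- c))"
    by (rule eval_word_fixed_letters)
      (use assms in \<open>auto simp: gen_power_in_words, auto simp: gen_power_def transvection_gen_def\<close>)
  moreover have "eval_word (free_group n) ?f (free_gen i) = free_gen i @ gen_power j c"
    using free_group_extend_hom(2)[OF group_free_group f assms(1)]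
    by (simp add: transvection_gen_def)
  moreover have "eval_word (free_group n) ?f (free_gen i @ gen_power j (- c))
      = reduce (eval_word (free_group n) ?f (free_gen i)
          @ eval_word (free_group n) ?f (gen_power j (- c)))"
    using eval_word_append[OF group_free_group f, of "free_gen i" "gen_power j (- c)"]
      free_gen_in_carrier[OF assms(1)] gen_power_in_words[OF assms(2)]
    by simp
  moreover have "reduce (free_gen i @ gen_power j c @ gen_power j (- c)) = free_gen i"
    using reduce_append_reduce2[of "free_gen i" "gen_power j c @ gen_power j (- c)"]
    unfolding reduce_gen_power_cancel append_Nil2
    using reduce_reduced[of "free_gen i"] by (simp add: free_gen_def reduced_Cons)
  ultimately show ?thesis
    using True reduce_append_reduce2[of "free_gen i @ gen_power j c" "gen_power j (- c)"]
    by (simp add: transvection_gen_def)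
next
  case False
  then show ?thesis
    using free_group_extend_hom(2)[OF group_free_group transvection_gen_closed[OF assms(1-3)] assms(4)]
    by (simp add: transvection_gen_def)
qed

text \<open>The transvections with exponents $c$ and $-c$ are inverse to each other.\<close>

lemma transvection_in_auto:
  assumes "i \<in> {1..n}" "j \<in> {1..n}" "i \<noteq> j"
  shows "transvection n i j c \<in> auto (free_group n)"
proof -
  let ?G = "free_group n"
  let ?h = "\<lambda>c. eval_word ?G (transvection_gen i j c)"
  note closed = transvection_gen_closed[OF assms]
  have hom: "?h d \<in> hom ?G ?G" for d
    by (rule free_group_extend_hom(1)[OF group_free_group closed])
  have cancel: "?h d (?h (- d) v) = v" if "v \<in> carrier ?G" for d v
    by (rule eval_word_cancel[OF closed closed transvection_gen_cancel[OF assms] that])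
  have "bij_betw (?h c) (carrier ?G) (carrier ?G)"
    by (rule bij_betw_byWitness[where f' = "?h (- c)"])
      (use cancel[of _ c] cancel[of _ "- c"] hom_in_carrier[OF hom]
        in \<open>auto simp del: free_group_simps\<close>)
  then have "transvection n i j c \<in> Bij (carrier ?G)"
    unfolding Bij_def transvection_def by (simp cong: bij_betw_cong del: free_group_simps)
  moreover have "transvection n i j c \<in> hom ?G ?G"
    unfolding transvection_def
    by (rule group.hom_restrict[OF group_free_group hom]) simp
  ultimately show ?thesis by (simp add: auto_def)
qed

lemma length_transvection_le:
  assumes "i \<in> {1..n}" "j \<in> {1..n}" "i \<noteq> j" "v \<in> carrier (free_group n)"
  shows "length (transvection n i j c v) \<le> (1 + nat \<bar>c\<bar>) * length v"
proof -
  have "length (transvection_gen i j c l) \<le> 1 + nat \<bar>c\<bar>" for l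
    by (simp add: transvection_gen_def free_gen_def gen_power_def)
  then show ?thesis
    using length_eval_word_le[OF transvection_gen_closed[OF assms(1-3)],
        of c "1 + nat \<bar>c\<bar>" v] assms(4)
    by (simp add: transvection_def)
qed

lemma exponent_sum_transvection:
  assumes "i \<in> {1..n}" "j \<in> {1..n}" "i \<noteq> j" "v \<in> carrier (free_group n)"
  shows "exponent_sum i (transvection n i j c v) = exponent_sum i v"
    and "exponent_sum j (transvection n i j c v) = exponent_sum j v + c * exponent_sum i v"
proof -
  have "exponent_sum k (transvection n i j c v)
      = exponent_sum k v + (if k = j then c else 0) * exponent_sum i v" for k
    unfolding transvection_def
    using assms(4) exponent_sum_eval_word[OF transvection_gen_closed[OF assms(1-3), of c],
        of k "if k = j then c else 0" i v]
    by (simp add: transvection_gen_def exponent_sum_append exponent_sum_gen_power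
        exponent_sum_free_gen)
  then show "exponent_sum i (transvection n i j c v) = exponent_sum i v"
    and "exponent_sum j (transvection n i j c v) = exponent_sum j v + c * exponent_sum i v"
    using assms(3) by simp_all
qed

section \<open>The Euclidean algorithm on two exponent sums\<close>

text \<open>With $B = q A + R$, the difference of the two sides is $q (A - 1 - R)$, and $R \le A - 1$.\<close>

lemma euclid_step_cost:
  fixes A B :: nat
  assumes "0 < A"
  shows "(1 + B div A) * (1 + B mod A) \<le> 1 + B"
proof -
  have "B div A * (1 + B mod A) \<le> B div A * A"
    using assms by (intro mult_left_mono) (auto simp: Suc_le_eq)
  then have "(1 + B div A) * (1 + B mod A) \<le> 1 + (B div A * A + B mod A)"
    by (simp only: distrib_right mult_1)
  then show ?thesis by (simp only: div_mult_mod_eq)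
qed

text \<open>Division with remainder in terms of absolute values: $c$ is the exponent of the transvection
  that takes $b$ to its remainder up to sign, and $|c|$ is the quotient whose cost \<open>euclid_step_cost\<close> bounds.\<close>

lemma ex_int_abs_eq_mod:
  fixes a b :: int
  assumes "a \<noteq> 0"
  shows "\<exists>c. nat \<bar>c\<bar> = nat \<bar>b\<bar> div nat \<bar>a\<bar> \<and> nat \<bar>b + c * a\<bar> = nat \<bar>b\<bar> mod nat \<bar>a\<bar>"
proof -
  let ?q = "\<bar>b\<bar> div \<bar>a\<bar>"
  have q: "0 \<le> ?q" by (simp add: pos_imp_zdiv_nonneg_iff assms)
  \<comment> \<open>Adding \<open>c * a\<close> must bring \<open>b\<close> closer to zero, which determines the sign of \<open>c\<close>.\<close>
  define c where "c = (if (0 \<le> a) = (0 \<le> b) then - ?q else ?q)"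
  have "\<bar>c\<bar> = ?q" using q by (simp add: c_def)
  moreover have "\<bar>b + c * a\<bar> = \<bar>b\<bar> mod \<bar>a\<bar>"
  proof -
    have "\<bar>b + c * a\<bar> = \<bar>\<bar>b\<bar> - ?q * \<bar>a\<bar>\<bar>"
      by (cases "0 \<le> a"; cases "0 \<le> b"; simp add: c_def)
    also have "\<bar>b\<bar> - ?q * \<bar>a\<bar> = \<bar>b\<bar> mod \<bar>a\<bar>"
      by (rule minus_div_mult_eq_mod)
    finally show ?thesis using assms by simp
  qed
  ultimately show ?thesis
    by (intro exI[of _ c]) (simp add: nat_div_distrib nat_mod_distrib)
qed

text \<open>
  The induction is on $|a| + |b|$, where $a$ and $b$ are the exponent sums of $x_i$ and $x_j$. By
  symmetry $|a| \le |b|$, and if $a \neq 0$, one transvection replaces $|b|$ by its remainder modulo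
  $|a|$. The bound is the potential $(1 + |a|)(1 + |b|)$ that pays for this step by \<open>euclid_step_cost\<close>.
\<close>

lemma ex_automorphism_zero_exponent_sum:
  assumes "i \<in> {1..n}" "j \<in> {1..n}" "i \<noteq> j" "w \<in> carrier (free_group n)"
  shows "\<exists>\<alpha> \<in> auto (free_group n).
    (exponent_sum i (\<alpha> w) = 0 \<or> exponent_sum j (\<alpha> w) = 0) \<and>
    length (\<alpha> w)
      \<le> (1 + nat \<bar>exponent_sum i w\<bar>) * (1 + nat \<bar>exponent_sum j w\<bar>) * length w"
  using assms
proof (induction "nat \<bar>exponent_sum i w\<bar> + nat \<bar>exponent_sum j w\<bar>" arbitrary: i j w
    rule: less_induct)
  case less
  let ?G = "free_group n"
  \<comment> \<open>The induction hypothesis is restated for the given pair, so that \<open>step\<close> applies to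
      \<open>(i, j)\<close> as well as to \<open>(j, i)\<close>.\<close>
  have step: "\<exists>\<alpha> \<in> auto ?G. (exponent_sum i (\<alpha> w) = 0 \<or> exponent_sum j (\<alpha> w) = 0) \<and>
      length (\<alpha> w) \<le> (1 + nat \<bar>exponent_sum i w\<bar>) * (1 + nat \<bar>exponent_sum j w\<bar>) * length w"
    if ij: "i \<in> {1..n}" "j \<in> {1..n}" "i \<noteq> j"
      and le: "nat \<bar>exponent_sum i w\<bar> \<le> nat \<bar>exponent_sum j w\<bar>"
      and IH: "\<And>w'. nat \<bar>exponent_sum i w'\<bar> + nat \<bar>exponent_sum j w'\<bar>
          < nat \<bar>exponent_sum i w\<bar> + nat \<bar>exponent_sum j w\<bar> \<Longrightarrow> w' \<in> carrier ?G \<Longrightarrow>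
        \<exists>\<alpha> \<in> auto ?G. (exponent_sum i (\<alpha> w') = 0 \<or> exponent_sum j (\<alpha> w') = 0) \<and>
          length (\<alpha> w')
            \<le> (1 + nat \<bar>exponent_sum i w'\<bar>) * (1 + nat \<bar>exponent_sum j w'\<bar>) * length w'"
    for i j
  proof (cases "exponent_sum i w = 0")
    case True
    have "(\<lambda>v \<in> carrier ?G. v) \<in> auto ?G"
      by (rule group.id_in_auto[OF group_free_group])
    then show ?thesis
      by (rule bexI[rotated]) (use True less.prems(4) in \<open>simp add: restrict_apply\<close>)
  next
    case False
    define A where "A = nat \<bar>exponent_sum i w\<bar>"
    define B where "B = nat \<bar>exponent_sum j w\<bar>"
    have A: "0 < A" using False by (simp add: A_def)
    obtain c where c: "nat \<bar>c\<bar> = B div A"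
      "nat \<bar>exponent_sum j w + c * exponent_sum i w\<bar> = B mod A"
      using ex_int_abs_eq_mod[OF False] unfolding A_def B_def by blast
    define t where "t = transvection n i j c"
    have t: "t \<in> auto ?G" unfolding t_def by (rule transvection_in_auto[OF ij])
    then have tw: "t w \<in> carrier ?G"
      using hom_in_carrier[of t ?G ?G w] less.prems(4) by (simp add: auto_def)
    have tA: "nat \<bar>exponent_sum i (t w)\<bar> = A" and tB: "nat \<bar>exponent_sum j (t w)\<bar> = B mod A"
      using exponent_sum_transvection[OF ij less.prems(4), of c] c(2)
      by (simp_all add: t_def A_def)
    have "B mod A < B" using A le mod_less_divisor[OF A, of B] unfolding A_def B_def by linarith
    then obtain \<beta> where \<beta>: "\<beta> \<in> auto ?G"
      "exponent_sum i (\<beta> (t w)) = 0 \<or> exponent_sum j (\<beta> (t w)) = 0"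
      "length (\<beta> (t w)) \<le> (1 + A) * (1 + B mod A) * length (t w)"
      using IH[of "t w"] tw unfolding tA tB A_def[symmetric] B_def[symmetric] by auto
    have "length (t w) \<le> (1 + B div A) * length w"
      using length_transvection_le[OF ij less.prems(4), of c] by (simp only: t_def c(1))
    then have "length (\<beta> (t w)) \<le> (1 + A) * (1 + B mod A) * ((1 + B div A) * length w)"
      by (rule order_trans[OF \<beta>(3) mult_left_mono]) simp
    also have "\<dots> = (1 + A) * ((1 + B div A) * (1 + B mod A)) * length w"
      by (simp only: mult_ac)
    also have "\<dots> \<le> (1 + A) * (1 + B) * length w"
      by (intro mult_right_mono mult_left_mono euclid_step_cost A) simp_all
    finally have len: "length (\<beta> (t w)) \<le> (1 + A) * (1 + B) * length w" .
    have "compose (carrier ?G) \<beta> t \<in> auto ?G"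
      using subgroup.m_closed[OF group.subgroup_auto[OF group_free_group] \<beta>(1) t] \<beta>(1) t
      by (simp add: BijGroup_def auto_def del: free_group_simps)
    moreover have "compose (carrier ?G) \<beta> t w = \<beta> (t w)"
      using less.prems(4) by (simp add: compose_def)
    ultimately show ?thesis
      using \<beta>(2) len unfolding A_def B_def by metis
  qed
  show ?case
  proof (cases "nat \<bar>exponent_sum i w\<bar> \<le> nat \<bar>exponent_sum j w\<bar>")
    case True
    show ?thesis
      by (rule step[OF less.prems(1-3) True]) (rule less.hyps[OF _ less.prems(1-3)])
  next
    case False
    have IH: "\<exists>\<alpha> \<in> auto ?G. (exponent_sum j (\<alpha> w') = 0 \<or> exponent_sum i (\<alpha> w') = 0) \<and>
        length (\<alpha> w')
          \<le> (1 + nat \<bar>exponent_sum j w'\<bar>) * (1 + nat \<bar>exponent_sum i w'\<bar>) * length w'"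
      if "nat \<bar>exponent_sum j w'\<bar> + nat \<bar>exponent_sum i w'\<bar>
          < nat \<bar>exponent_sum j w\<bar> + nat \<bar>exponent_sum i w\<bar>" "w' \<in> carrier ?G" for w'
      by (rule less.hyps[OF _ less.prems(2,1) less.prems(3)[symmetric] that(2)])
        (use that(1) in simp)
    have "\<exists>\<alpha> \<in> auto ?G. (exponent_sum j (\<alpha> w) = 0 \<or> exponent_sum i (\<alpha> w) = 0) \<and>
        length (\<alpha> w) \<le> (1 + nat \<bar>exponent_sum j w\<bar>) * (1 + nat \<bar>exponent_sum i w\<bar>) * length w"
      by (rule step[OF less.prems(2,1) less.prems(3)[symmetric] _ IH]) (use False in simp)
    then show ?thesis
      by (simp only: disj_commute[of "exponent_sum j _ = 0"]
          mult.commute[of "1 + nat \<bar>exponent_sum j w\<bar>"])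
  qed
qed

theorem theorem1p1:
  shows "\<forall>n::nat. n \<ge> 2 \<longrightarrow>
    (\<exists>p :: real poly. \<forall>w \<in> carrier (free_group n). \<exists>\<alpha> \<in> auto (free_group n).
       (\<exists>i \<in> {1..n}. exponent_sum i (\<alpha> w) = 0) \<and>
       real (word_length (\<alpha> w)) \<le> poly p (real (word_length w)))"
proof (intro allI impI exI ballI)
  fix n :: nat and w
  assume n: "2 \<le> n" and w: "w \<in> carrier (free_group n)"
  have one: "1 \<in> {1..n}" and two: "2 \<in> {1..n}" using n by auto
  obtain \<alpha> where \<alpha>: "\<alpha> \<in> auto (free_group n)"
    "exponent_sum 1 (\<alpha> w) = 0 \<or> exponent_sum 2 (\<alpha> w) = 0"
    "length (\<alpha> w)
      \<le> (1 + nat \<bar>exponent_sum 1 w\<bar>) * (1 + nat \<bar>exponent_sum 2 w\<bar>) * length w"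
    using ex_automorphism_zero_exponent_sum[OF one two _ w] by auto
  have "nat \<bar>exponent_sum k w\<bar> \<le> length w" for k
    using abs_exponent_sum_le_length[of k w] by simp
  then have "length (\<alpha> w) \<le> (1 + length w) * (1 + length w) * length w"
    by (intro order_trans[OF \<alpha>(3)] mult_right_mono mult_mono) simp_all
  then have "real (length (\<alpha> w)) \<le> real ((1 + length w) * (1 + length w) * length w)"
    by (simp only: of_nat_le_iff)
  then have "real (word_length (\<alpha> w)) \<le> poly ([:1, 1:] ^ 2 * [:0, 1:]) (real (word_length w))"
    by (simp add: word_length_def power2_eq_square algebra_simps)
  with \<alpha>(1,2) one two show "\<exists>\<alpha> \<in> auto (free_group n).
      (\<exists>i \<in> {1..n}. exponent_sum i (\<alpha> w) = 0) \<and>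
      real (word_length (\<alpha> w)) \<le> poly ([:1, 1:] ^ 2 * [:0, 1:]) (real (word_length w))"
    by blast
qed

end
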